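(* Consider the composite problem $\min_{x\in\mathbb R^n} g(x)=f(x)+h(x)$ and the IPAG method described in the context, under the standing assumptions (A1)–(A4), where at each iteration $k\ge1$ an $e_k$-approximate solution for step (2) and a $\rho_k$-approximate solution for step (3) are available through the inner algorithm $\mathcal M$. Choose $\alpha_k=\frac2{k+1}$, $\gamma_k=\frac k{4L}$, $\lambda_k=\frac1{2L}$, $\Gamma_k=\frac2{k(k+1)}$ and $N_k=k+1$. For $k\ge1$ let $\hat y_k^r=\mathrm{prox}_{\lambda_kh}(z_k-\lambda_k\nabla f(z_k))$ and let $\hat y_k$ be a $\rho_k$-approximate solution of this proximal problem. With $B=B_1^2+B_2^2+B_3^2+C^2$, for all $T>0$, $$\mathbb E\big[\|\hat y_N-z_N\|^2+\|\hat y_N^r-z_N\|^2\big]\le\frac{128}{LT^3}\Big[2BT(T+1)\Big(\frac{\ell}4+\frac{13\tau^2}{64LB}+4L\Big)+\sum_{k=1}^T\Big(\frac{2e_k}{\Gamma_k}+\frac{\rho_k(1+k)}{\Gamma_k}+\frac{4L^2\rho_k}{\Gamma_k}\Big)\Big].$$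
   Context: Problem: minimize $g(x)=f(x)+h(x)$ over $\mathbb R^n$, where $f(x)=\mathbb E[F(x,\zeta(\omega))]$ for a random vector $\zeta$ on a probability space $(\Omega,\mathcal F,\mathbb P)$, $f$ smooth and possibly nonconvex, $h$ convex and possibly nonsmooth; an optimal solution $x^*$ exists. For $\gamma>0$, $\mathrm{prox}_{\gamma h}(y)=\mathrm{prox}_{\gamma,h}(y)\triangleq\arg\min_u\{h(u)+\frac1{2\gamma}\|u-y\|^2\}$. A point $\tilde x$ is a $\rho$-approximate solution of this proximal problem if $\frac1{2\gamma}\|\tilde x-y\|^2+h(\tilde x)\le\rho+\min_x\{\frac1{2\gamma}\|x-y\|^2+h(x)\}$. Standing assumptions: (A1) there exist $L,\ell\ge0$ with $-\frac\ell2\|y-x\|^2\le f(y)-f(x)-\langle\nabla f(x),y-x\rangle\le\frac L2\|y-x\|^2$ for all $x,y$. (A2) There is $C>0$ with $\|\mathrm{prox}_{\gamma,h}(y)\|\le C$ for all $\gamma>0,y$. (A3) With $\xi_k=\nabla f(z_k)-\nabla F(z_k,\omega_k)$ and $\bar\xi_k=\frac1{N_k}\sum_{j=1}^{N_k}(\nabla f(z_k)-\nabla F(z_k,\omega_{j,k}))$: a.s. $\mathbb E[\xi_k\mid\mathcal F_k]=0$ and $\mathbb E[\|\bar\xi_k\|^2\mid\mathcal F_k]\le\tau^2/N_k$ for some $\tau>0$, where $\mathcal F_k=\sigma(z_0,\bar\xi_0,\dots,z_{k-1},\bar\xi_{k-1})$. (A4) There is an algorithm $\mathcal M$ such that for any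 $c$, $\gamma>0$, with $\tilde u=\mathrm{prox}_{\gamma h}(c)$, started at $u_0$ it outputs after $t$ steps $u$ with $\|u-\tilde u\|^2\le(a_1\|u_0-\tilde u\|^2+a_2)/t^2$ for some $a_1,a_2>0$. IPAG method: input $x_0,y_0$, positive $\{\alpha_k,\gamma_k,\lambda_k\}$, batch sizes $N_k$. For $k=1,\dots,T$: (1) $z_k=(1-\alpha_k)y_{k-1}+\alpha_kx_{k-1}$; (2) $x_k$ is an $e_k$-approximate solution of $\mathrm{prox}_{\gamma_kh}(x_{k-1}-\gamma_k(\nabla f(z_k)+\bar\xi_k))$; (3) $y_k$ is a $\rho_k$-approximate solution of $\mathrm{prox}_{\lambda_kh}(z_k-\lambda_k(\nabla f(z_k)+\bar\xi_k))$. Output $z_N$, with $N$ random in $\{\lfloor T/2\rfloor,\dots,T\}$, $\mathrm{Prob}\{N=k\}$ proportional to $\frac{1-L\lambda_k}{16\lambda_k\Gamma_k}$. $B_1,B_2,B_3>0$ denote constants with $\|x_k\|\le B_1$, $\|y_k\|\le B_2$, $\|z_k\|\le B_3$ for all $k$. *)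

theory Defs
  imports "HOL-Analysis.Analysis" "HOL-Probability.Probability"
begin

definition ereal_convex :: "('a::real_vector \<Rightarrow> ereal) \<Rightarrow> bool" where
  "ereal_convex h \<longleftrightarrow> (\<forall>x y t. 0 \<le> t \<and> t \<le> 1 \<longrightarrow>
      h ((1 - t) *\<^sub>R x + t *\<^sub>R y) \<le> ereal (1 - t) * h x + ereal t * h y)"

definition ereal_proper :: "('a \<Rightarrow> ereal) \<Rightarrow> bool" where
  "ereal_proper h \<longleftrightarrow> (\<exists>u. h u < \<infinity>) \<and> (\<forall>u. - \<infinity> < h u)"

definition ereal_lsc :: "('a::topological_space \<Rightarrow> ereal) \<Rightarrow> bool" where
  "ereal_lsc h \<longleftrightarrow> (\<forall>x X. X \<longlonglongrightarrow> x \<longrightarrow> h x \<le> liminf (\<lambda>n. h (X n)))"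

definition prox_obj :: "real \<Rightarrow> ('a::real_normed_vector \<Rightarrow> ereal) \<Rightarrow> 'a \<Rightarrow> 'a \<Rightarrow> ereal" where
  "prox_obj \<gamma> h y u = ereal ((norm (u - y))\<^sup>2 / (2 * \<gamma>)) + h u"

definition prox :: "real \<Rightarrow> ('a::real_normed_vector \<Rightarrow> ereal) \<Rightarrow> 'a \<Rightarrow> 'a" where
  "prox \<gamma> h y = (SOME u. \<forall>v. prox_obj \<gamma> h y u \<le> prox_obj \<gamma> h y v)"

definition approx_prox :: "real \<Rightarrow> real \<Rightarrow> ('a::real_normed_vector \<Rightarrow> ereal) \<Rightarrow> 'a \<Rightarrow> 'a \<Rightarrow> bool" where
  "approx_prox \<rho> \<gamma> h y x' \<longleftrightarrow> prox_obj \<gamma> h y x' \<le> ereal \<rho> + (INF u. prox_obj \<gamma> h y u)"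

text \<open>F_k = sigma(z_i, xibar_i : 1 <= i < k) (the algorithm's iterates start at index 1).\<close>
definition gen_filtration :: "'o measure \<Rightarrow> (nat \<Rightarrow> 'o \<Rightarrow> 'a::topological_space)
    \<Rightarrow> (nat \<Rightarrow> 'o \<Rightarrow> 'a) \<Rightarrow> nat \<Rightarrow> 'o measure" where
  "gen_filtration M z xib k = sigma (space M)
     (\<Union>i\<in>{1..<k}. {z i -` A \<inter> space M | A. A \<in> sets borel}
                  \<union> {xib i -` A \<inter> space M | A. A \<in> sets borel})"

end

theory Submission
  imports Defs
begin

text \<open>
  Let s be an optimal solution. It is the proximal point of s - (1/L) grad f(s), so (A2) gives
  |s| \<le> C. Comparing y_k with (1 - alpha_k) y_{k-1} + alpha_k x_k and x_k with s bounds
  (f + h)(y_k) - (f + h)(s) by (1 - alpha_k) times its predecessor, minus (L/2) |y_k - z_k|^2, plus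
  error terms; dividing by Gamma_k makes this telescope. Since the iterates are bounded, the
  distances |s - x_{k-1}| and |s - z_k| need not telescope and are simply absorbed by B. Strong
  convexity of the proximal objective compares |y_k - z_k| with the residuals of the noise-free
  steps at the cost of multiples of |xibar_k|^2 and rho_k. In expectation the only term linear in
  the noise, its inner product with s - x_{k-1}, vanishes, and |xibar_k|^2 contributes
  tau^2 / (k + 1).
\<close>

section \<open>Exact and inexact proximal points\<close>

lemma ereal_proper_finite:
  assumes "ereal_proper h" "h u < \<infinity>"
  shows "h u = ereal (real_of_ereal (h u))"
  using assms by (cases "h u") (auto simp: ereal_proper_def)

lemma approx_prox_finite:
  assumes "ereal_proper h" "approx_prox \<rho> g h c p"
  shows "h p < \<infinity>"
proof -
  obtain u where u: "h u < \<infinity>" using assms(1) by (auto simp: ereal_proper_def)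
  have "prox_obj g h c p \<le> ereal \<rho> + prox_obj g h c u"
    using assms(2) unfolding approx_prox_def
    by (meson INF_lower UNIV_I add_left_mono order_trans)
  also have "\<dots> < \<infinity>" using u by (simp add: prox_obj_def)
  finally show ?thesis by (auto simp: prox_obj_def)
qed

lemma approx_prox_le:
  assumes "ereal_proper h" "approx_prox \<rho> g h c p" "h u < \<infinity>"
  shows "(norm (p - c))\<^sup>2 / (2 * g) + real_of_ereal (h p)
    \<le> \<rho> + (norm (u - c))\<^sup>2 / (2 * g) + real_of_ereal (h u)"
proof -
  have "prox_obj g h c p \<le> ereal \<rho> + prox_obj g h c u"
    using assms(2) unfolding approx_prox_def
    by (meson INF_lower UNIV_I add_left_mono order_trans)
  moreover note ereal_proper_finite[OF assms(1) approx_prox_finite[OF assms(1,2)]]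
    and ereal_proper_finite[OF assms(1,3)]
  ultimately show ?thesis unfolding prox_obj_def
    by (metis (no_types, lifting) add.assoc ereal_less_eq(3) plus_ereal.simps(1))
qed

text \<open>Compare \<open>p\<close> with itself.\<close>

lemma approx_prox_error_nonneg:
  assumes "ereal_proper h" "approx_prox \<rho> g h c p"
  shows "\<rho> \<ge> 0"
  using approx_prox_le[OF assms approx_prox_finite[OF assms]] by simp

lemma norm_shift_square_div:
  fixes u c v :: "'a::real_inner"
  assumes "g > 0"
  shows "(norm (u - (c - g *\<^sub>R v)))\<^sup>2 / (2 * g)
    = (norm (u - c))\<^sup>2 / (2 * g) + inner v (u - c) + g / 2 * (norm v)\<^sup>2"
proof -
  have "(norm (u - (c - g *\<^sub>R v)))\<^sup>2 = (norm (u - c))\<^sup>2 + 2 * g * inner v (u - c) + g\<^sup>2 * (norm v)\<^sup>2"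
    unfolding power2_norm_eq_inner
    by (simp add: inner_simps inner_commute power2_eq_square algebra_simps)
  with assms show ?thesis by (simp add: field_simps power2_eq_square)
qed

text \<open>Expanding the square around \<open>c\<close> turns the proximal objective into a linear
  model with a quadratic penalty; the constant \<open>g / 2 * (norm v)\<^sup>2\<close> occurs on
  both sides and cancels.\<close>

lemma approx_prox_gradient_step:
  fixes h :: "'a::real_inner \<Rightarrow> ereal"
  assumes "ereal_proper h" "approx_prox \<rho> g h (c - g *\<^sub>R v) p" "h u < \<infinity>" "g > 0"
  shows "real_of_ereal (h p) + inner v (p - c) + (norm (p - c))\<^sup>2 / (2 * g)
    \<le> \<rho> + real_of_ereal (h u) + inner v (u - c) + (norm (u - c))\<^sup>2 / (2 * g)"
  using approx_prox_le[OF assms(1-3)] norm_shift_square_div[OF assms(4), of _ c v]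
  by simp

lemma ereal_convex_finite:
  assumes "ereal_convex h" "ereal_proper h" "h u < \<infinity>" "h v < \<infinity>" "0 \<le> t" "t \<le> 1"
  shows "h ((1 - t) *\<^sub>R u + t *\<^sub>R v) < \<infinity>"
    and "real_of_ereal (h ((1 - t) *\<^sub>R u + t *\<^sub>R v))
      \<le> (1 - t) * real_of_ereal (h u) + t * real_of_ereal (h v)"
proof -
  have "h ((1 - t) *\<^sub>R u + t *\<^sub>R v) \<le> ereal (1 - t) * h u + ereal t * h v"
    using assms by (auto simp: ereal_convex_def)
  also have "\<dots> = ereal ((1 - t) * real_of_ereal (h u) + t * real_of_ereal (h v))"
    using ereal_proper_finite[OF assms(2,3)] ereal_proper_finite[OF assms(2,4)]
    by (metis plus_ereal.simps(1) times_ereal.simps(1))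
  finally have *: "h ((1 - t) *\<^sub>R u + t *\<^sub>R v)
    \<le> ereal ((1 - t) * real_of_ereal (h u) + t * real_of_ereal (h v))" .
  then show fin: "h ((1 - t) *\<^sub>R u + t *\<^sub>R v) < \<infinity>"
    using le_less_trans by fastforce
  show "real_of_ereal (h ((1 - t) *\<^sub>R u + t *\<^sub>R v))
      \<le> (1 - t) * real_of_ereal (h u) + t * real_of_ereal (h v)"
    using * ereal_proper_finite[OF assms(2) fin] by (metis ereal_less_eq(3))
qed

lemma norm_convex_combination_square:
  fixes q u c :: "'a::real_inner"
  shows "(norm ((1 - t) *\<^sub>R q + t *\<^sub>R u - c))\<^sup>2
    = (1 - t) * (norm (q - c))\<^sup>2 + t * (norm (u - c))\<^sup>2 - t * (1 - t) * (norm (u - q))\<^sup>2"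
  unfolding power2_norm_eq_inner
  by (simp add: inner_simps inner_commute power2_eq_square algebra_simps)

text \<open>Quadratic growth at a minimizer. Testing minimality at
  \<open>(1 - t) *\<^sub>R q + t *\<^sub>R u\<close> gives
  \<open>P \<le> (1 - t) * P + t * Q - t * (1 - t) * d\<close>; cancel, divide by \<open>t\<close>
  and let \<open>t\<close> tend to 0 from the right.\<close>

lemma approx_prox_exact_strong:
  fixes h :: "'a::real_inner \<Rightarrow> ereal"
  assumes "ereal_convex h" "ereal_proper h" "approx_prox 0 g h c q" "h u < \<infinity>" "g > 0"
  shows "(norm (q - c))\<^sup>2 / (2 * g) + real_of_ereal (h q) + (norm (u - q))\<^sup>2 / (2 * g)
    \<le> (norm (u - c))\<^sup>2 / (2 * g) + real_of_ereal (h u)"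
proof -
  define P where "P = (norm (q - c))\<^sup>2 / (2 * g) + real_of_ereal (h q)"
  define Q where "Q = (norm (u - c))\<^sup>2 / (2 * g) + real_of_ereal (h u)"
  define d where "d = (norm (u - q))\<^sup>2 / (2 * g)"
  have hq: "h q < \<infinity>" by (rule approx_prox_finite[OF assms(2,3)])
  have step: "P + (1 - t) * d \<le> Q" if t: "0 < t" "t < 1" for t
  proof -
    have "P \<le> (norm ((1 - t) *\<^sub>R q + t *\<^sub>R u - c))\<^sup>2 / (2 * g)
        + real_of_ereal (h ((1 - t) *\<^sub>R q + t *\<^sub>R u))"
      using approx_prox_le[OF assms(2,3) ereal_convex_finite(1)[OF assms(1,2) hq assms(4)]] t
      by (simp add: P_def)
    also have "\<dots> \<le> ((1 - t) * (norm (q - c))\<^sup>2 + t * (norm (u - c))\<^sup>2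
        - t * (1 - t) * (norm (u - q))\<^sup>2) / (2 * g)
        + ((1 - t) * real_of_ereal (h q) + t * real_of_ereal (h u))"
      using ereal_convex_finite(2)[OF assms(1,2) hq assms(4)] t
      by (simp add: norm_convex_combination_square)
    also have "\<dots> = (1 - t) * P + t * Q - t * ((1 - t) * d)"
      by (simp add: P_def Q_def d_def add_divide_distrib diff_divide_distrib algebra_simps)
    finally have "t * (P + (1 - t) * d) \<le> t * Q" by (simp add: algebra_simps)
    with t show ?thesis by simp
  qed
  have "P + d \<le> Q"
  proof (rule tendsto_upperbound)
    show "((\<lambda>t. P + (1 - t) * d) \<longlongrightarrow> P + d) (at_right 0)" by (auto intro!: tendsto_eq_intros)
    show "\<forall>\<^sub>F t in at_right 0. P + (1 - t) * d \<le> Q"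
      unfolding eventually_at_right_field by (intro exI[of _ 1]) (auto intro: step)
  qed auto
  then show ?thesis by (simp add: P_def Q_def d_def)
qed

lemma exact_approx_prox_iff:
  "approx_prox 0 g h c q \<longleftrightarrow> (\<forall>v. prox_obj g h c q \<le> prox_obj g h c v)"
  by (auto simp: approx_prox_def le_INF_iff zero_ereal_def[symmetric])

text \<open>\<open>prox\<close> is a Hilbert choice, so it is a minimizer as soon as some minimizer
  exists.\<close>

lemma prox_is_minimizer:
  assumes "approx_prox 0 g h c q"
  shows "approx_prox 0 g h c (prox g h c)"
  unfolding exact_approx_prox_iff prox_def
  by (rule someI_ex) (use assms exact_approx_prox_iff in blast)

text \<open>Quadratic growth around \<open>q\<close> rules out a second minimizer, so the choice
  made by \<open>prox\<close> is forced.\<close>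

lemma prox_eqI:
  fixes h :: "'a::real_inner \<Rightarrow> ereal"
  assumes "ereal_convex h" "ereal_proper h" "approx_prox 0 g h c q" "g > 0"
  shows "prox g h c = q"
proof -
  let ?p = "prox g h c"
  have p: "approx_prox 0 g h c ?p" by (rule prox_is_minimizer[OF assms(3)])
  have hp: "h ?p < \<infinity>" by (rule approx_prox_finite[OF assms(2) p])
  have hq: "h q < \<infinity>" by (rule approx_prox_finite[OF assms(2,3)])
  have "(norm (?p - q))\<^sup>2 / (2 * g) \<le> 0"
    using approx_prox_exact_strong[OF assms(1-3) hp assms(4)]
      approx_prox_le[OF assms(2) p hq] by linarith
  with assms(4) show ?thesis by (simp add: divide_le_0_iff)
qed

text \<open>Direct method: coercivity confines the tail of a minimizing sequence to a closed ball,
  compactness supplies a limit point, and lower semicontinuity makes it optimal. If \<phi> is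
  infinite everywhere, every point is a minimizer.\<close>

lemma ereal_lsc_coercive_attains_min:
  fixes \<phi> :: "'a::euclidean_space \<Rightarrow> ereal"
  assumes lsc: "ereal_lsc \<phi>" and "a > 0" and coercive: "\<And>u. ereal (a * (norm (u - c))\<^sup>2 - b) \<le> \<phi> u"
  shows "\<exists>q. \<forall>v. \<phi> q \<le> \<phi> v"
proof (cases "\<exists>w. \<phi> w < \<infinity>")
  case True
  then obtain w where w: "\<phi> w < \<infinity>" by blast
  define m where "m = (INF v. \<phi> v)"
  have "\<exists>s. (\<forall>n. s n \<in> range \<phi>) \<and> s \<longlonglongrightarrow> m"
    unfolding m_def by (rule Inf_as_limit) simp
  then obtain t where t: "\<And>n. t n \<in> range \<phi>" "t \<longlonglongrightarrow> m" by blast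
  from t(1) have "\<forall>n. \<exists>v. t n = \<phi> v" by auto
  then obtain X where "\<And>n. t n = \<phi> (X n)" by metis
  then have "t = (\<lambda>n. \<phi> (X n))" by auto
  with t(2) have X: "(\<lambda>n. \<phi> (X n)) \<longlonglongrightarrow> m" by simp
  have "m < \<infinity>" using w unfolding m_def by (meson INF_lower UNIV_I le_less_trans)
  \<comment> \<open>A real level above the infimum; dropping the first \<open>n0\<close> terms keeps
    the sequence below it and hence bounded.\<close>
  then obtain r where r: "m < ereal r" by (metis ereal_dense2)
  obtain n0 where n0: "\<And>n. n \<ge> n0 \<Longrightarrow> \<phi> (X n) < ereal r"
    using order_tendstoD(2)[OF X r] by (auto simp: eventually_sequentially)
  define Y where "Y n = X (n + n0)" for n
  have Y: "(\<lambda>n. \<phi> (Y n)) \<longlonglongrightarrow> m" unfolding Y_def using LIMSEQ_ignore_initial_segment[OF X] .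
  have "Y n \<in> cball c (sqrt ((r + b) / a))" for n
  proof -
    have "ereal (a * (norm (Y n - c))\<^sup>2 - b) < ereal r"
      using coercive[of "Y n"] n0[of "n + n0"] unfolding Y_def
      by (meson le_add2 le_less_trans)
    then have "(norm (Y n - c))\<^sup>2 \<le> (r + b) / a" using \<open>a > 0\<close> by (simp add: field_simps)
    then show ?thesis by (simp add: dist_norm norm_minus_commute real_le_rsqrt)
  qed
  then obtain q s where q: "strict_mono s" "(Y \<circ> s) \<longlonglongrightarrow> q"
    using compact_imp_seq_compact[OF compact_cball] unfolding seq_compact_def by metis
  have "\<phi> q \<le> liminf (\<lambda>n. \<phi> ((Y \<circ> s) n))" using lsc q(2) unfolding ereal_lsc_def by blast
  also have "\<dots> = m"
    using lim_imp_Liminf[OF _ LIMSEQ_subseq_LIMSEQ[OF Y q(1)]] by (simp add: o_def)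
  finally show ?thesis unfolding m_def by (metis INF_lower UNIV_I order_trans)
qed (auto simp: not_less)

lemma ereal_lsc_prox_obj:
  assumes "ereal_lsc h"
  shows "ereal_lsc (prox_obj g h c)"
  unfolding ereal_lsc_def
proof (intro allI impI)
  fix x X assume X: "X \<longlonglongrightarrow> (x :: 'a)"
  have "(\<lambda>n. (norm (X n - c))\<^sup>2 * inverse (2 * g)) \<longlonglongrightarrow> (norm (x - c))\<^sup>2 * inverse (2 * g)"
    by (intro tendsto_intros X)
  then have "(\<lambda>n. ereal ((norm (X n - c))\<^sup>2 / (2 * g))) \<longlonglongrightarrow> ereal ((norm (x - c))\<^sup>2 / (2 * g))"
    unfolding divide_inverse by (rule tendsto_ereal)
  from ereal_liminf_lim_add[OF this, of "\<lambda>n. h (X n)"]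
  have "liminf (\<lambda>n. prox_obj g h c (X n)) = ereal ((norm (x - c))\<^sup>2 / (2 * g)) + liminf (\<lambda>n. h (X n))"
    by (simp add: prox_obj_def)
  moreover have "h x \<le> liminf (\<lambda>n. h (X n))" using assms X by (auto simp: ereal_lsc_def)
  ultimately show "prox_obj g h c x \<le> liminf (\<lambda>n. prox_obj g h c (X n))"
    by (simp add: prox_obj_def add_left_mono)
qed

text \<open>Optimality and \<open>upper\<close> give \<open>h u \<ge> h s - inner v (u - s) - L / 2
  * (norm (u - s))\<^sup>2\<close>, and the penalty \<open>1 / (2 * g)\<close> dominates this
  curvature because \<open>L * g \<le> 1\<close>. A uniform bound on proximal points thereby bounds
  \<open>s\<close>.\<close>

lemma composite_minimizer_prox_fixed_point:
  fixes f :: "'a::real_inner \<Rightarrow> real"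
  assumes "ereal_convex h" "ereal_proper h"
    and opt: "\<And>u. ereal (f s) + h s \<le> ereal (f u) + h u"
    and upper: "\<And>u. f u - f s - inner v (u - s) \<le> L / 2 * (norm (u - s))\<^sup>2"
    and g: "g > 0" "L * g \<le> 1"
  shows "prox g h (s - g *\<^sub>R v) = s"
proof (rule prox_eqI[OF assms(1,2) _ g(1)])
  have "prox_obj g h (s - g *\<^sub>R v) s \<le> prox_obj g h (s - g *\<^sub>R v) u" for u
  proof (cases "h u < \<infinity>")
    case True
    then have "ereal (f u) + h u < \<infinity>" by simp
    then have hs: "h s < \<infinity>" using opt[of u] by (auto dest: le_less_trans)
    note fin = ereal_proper_finite[OF assms(2) hs] ereal_proper_finite[OF assms(2) True]
    have "f s + real_of_ereal (h s) \<le> f u + real_of_ereal (h u)"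
      using opt[of u] fin by (metis ereal_less_eq(3) plus_ereal.simps(1))
    moreover have "L / 2 * (norm (u - s))\<^sup>2 \<le> (norm (u - s))\<^sup>2 / (2 * g)"
      using g mult_right_mono[OF g(2), of "(norm (u - s))\<^sup>2"] by (simp add: field_simps)
    ultimately have "(norm (s - (s - g *\<^sub>R v)))\<^sup>2 / (2 * g) + real_of_ereal (h s)
        \<le> (norm (u - (s - g *\<^sub>R v)))\<^sup>2 / (2 * g) + real_of_ereal (h u)"
      using upper[of u] unfolding norm_shift_square_div[OF g(1)] by simp
    then show ?thesis unfolding prox_obj_def
      using fin by (metis ereal_less_eq(3) plus_ereal.simps(1))
  qed (simp add: prox_obj_def)
  then show "approx_prox 0 g h (s - g *\<^sub>R v) s" by (simp add: exact_approx_prox_iff)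
qed

text \<open>The composite minimizer bounds \<open>h\<close> below by a quadratic of leading
  coefficient \<open>- L / 2\<close>. The proximal term with parameter \<open>1 / (2 * L)\<close>
  contributes \<open>+ L\<close>, so the objective is coercive and attains its minimum.\<close>

lemma prox_exists_of_composite_minimizer:
  fixes f :: "'a::euclidean_space \<Rightarrow> real"
  assumes "ereal_proper h" "ereal_lsc h"
    and opt: "\<And>u. ereal (f s) + h s \<le> ereal (f u) + h u"
    and upper: "\<And>u. f u - f s - inner v (u - s) \<le> L / 2 * (norm (u - s))\<^sup>2"
    and L: "L > 0"
  shows "approx_prox 0 (1 / (2 * L)) h c (prox (1 / (2 * L)) h c)"
proof -
  obtain w where w: "h w < \<infinity>" using assms(1) by (auto simp: ereal_proper_def)
  then have "ereal (f w) + h w < \<infinity>" by simp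
  then have hs: "h s < \<infinity>" using opt[of w] by (auto dest: le_less_trans)
  have lower: "real_of_ereal (h s) - inner v (u - s) - L / 2 * (norm (u - s))\<^sup>2 \<le> real_of_ereal (h u)"
    if "h u < \<infinity>" for u
  proof -
    have "f s + real_of_ereal (h s) \<le> f u + real_of_ereal (h u)"
      using opt[of u] ereal_proper_finite[OF assms(1) hs] ereal_proper_finite[OF assms(1) that]
      by (metis ereal_less_eq(3) plus_ereal.simps(1))
    with upper[of u] show ?thesis by linarith
  qed
  define p where "p = c - s"
  \<comment> \<open>\<open>K\<close> is the coefficient of \<open>n = norm (u - c)\<close> once the
    lower bound at \<open>s\<close> is expanded around \<open>c\<close>. Absorbing
    \<open>K * n\<close> into a quarter of \<open>L * n\<^sup>2\<close> costs
    \<open>K\<^sup>2 / L\<close>, the first summand of \<open>b\<close>.\<close>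
  define K where "K = (norm v + L * norm p)"
  define b where "b = K\<^sup>2 / L + norm v * norm p + L / 2 * (norm p)\<^sup>2 - real_of_ereal (h s)"
  have "ereal (L / 4 * (norm (u - c))\<^sup>2 - b) \<le> prox_obj (1 / (2 * L)) h c u" for u
  proof (cases "h u < \<infinity>")
    case True
    define n where "n = norm (u - c)"
    have us: "norm (u - s) \<le> n + norm p"
      unfolding n_def p_def using norm_triangle_ineq[of "u - c" "c - s"] by simp
    have "inner v (u - s) \<le> norm v * (n + norm p)"
      by (meson us norm_cauchy_schwarz mult_left_mono norm_ge_zero order_trans)
    moreover have "(norm (u - s))\<^sup>2 \<le> (n + norm p)\<^sup>2" using us by (simp add: power_mono)
    then have "L / 2 * (norm (u - s))\<^sup>2 \<le> L / 2 * (n + norm p)\<^sup>2" using L by simp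
    moreover have "K * n \<le> L / 4 * n\<^sup>2 + K\<^sup>2 / L"
    proof -
      have "0 \<le> (L / 2 * n - K)\<^sup>2 / L" using L by simp
      also have "\<dots> = L / 4 * n\<^sup>2 - K * n + K\<^sup>2 / L" using L
        by (simp add: power2_eq_square field_simps)
      finally show ?thesis by simp
    qed
    moreover have "norm v * (n + norm p) + L / 2 * (n + norm p)\<^sup>2
      = K * n + norm v * norm p + L / 2 * (norm p)\<^sup>2 + L / 2 * n\<^sup>2"
      by (simp add: K_def power2_eq_square algebra_simps)
    ultimately have "L / 4 * n\<^sup>2 - b \<le> L * n\<^sup>2 + real_of_ereal (h u)"
      using lower[OF True] unfolding b_def by (simp add: field_simps)
    then have "ereal (L / 4 * n\<^sup>2 - b) \<le> ereal (L * n\<^sup>2) + ereal (real_of_ereal (h u))" by simp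
    then show ?thesis using ereal_proper_finite[OF assms(1) True]
      by (simp add: prox_obj_def n_def mult.commute)
  qed (simp add: prox_obj_def)
  from ereal_lsc_coercive_attains_min[OF ereal_lsc_prox_obj[OF assms(2)] _ this] L
  obtain q where "\<forall>v. prox_obj (1 / (2 * L)) h c q \<le> prox_obj (1 / (2 * L)) h c v" by auto
  then show ?thesis using prox_is_minimizer exact_approx_prox_iff by blast
qed

section \<open>Descent inequalities\<close>

text \<open>Test the \<open>y1\<close> step at \<open>u\<close> and the \<open>x1\<close> step at
  \<open>s\<close>, the latter weighted by \<alpha>. The linear terms in \<open>x1 - x0\<close>,
  noise included, cancel; the lower bounds on \<open>f\<close> at \<open>s\<close> and
  \<open>y0\<close> handle the gradient at \<open>z\<close>. The \<open>y1\<close> step supplies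
  \<open>L * (norm (y1 - z))\<^sup>2\<close>, of which \<open>upper\<close> consumes half. The
  alternative \<open>\<alpha> = 1\<close> allows a starting point \<open>y0\<close> outside the
  domain of \<open>h\<close>.\<close>

lemma accelerated_prox_step_descent:
  fixes h :: "'a::real_inner \<Rightarrow> ereal"
  assumes h: "ereal_convex h" "ereal_proper h" and L: "L > 0"
    and lower: "\<And>v. f z + inner G (v - z) - ell / 2 * (norm (v - z))\<^sup>2 \<le> f v"
    and upper: "f y1 \<le> f z + inner G (y1 - z) + L / 2 * (norm (y1 - z))\<^sup>2"
    and \<alpha>: "0 < \<alpha>" "\<alpha> \<le> 1" and g: "g > 0" "2 * L * \<alpha> * g \<le> 1"
    and z: "z = (1 - \<alpha>) *\<^sub>R y0 + \<alpha> *\<^sub>R x0"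
    and y0: "h y0 < \<infinity> \<or> \<alpha> = 1" and s: "h s < \<infinity>"
    and x1: "approx_prox e g h (x0 - g *\<^sub>R (G + \<xi>)) x1"
    and y1: "approx_prox \<rho> (1 / (2 * L)) h (z - (1 / (2 * L)) *\<^sub>R (G + \<xi>)) y1"
  shows "f y1 + real_of_ereal (h y1) - (f s + real_of_ereal (h s)) + L / 2 * (norm (y1 - z))\<^sup>2
    \<le> (1 - \<alpha>) * (f y0 + real_of_ereal (h y0) - (f s + real_of_ereal (h s))) + \<rho> + \<alpha> * e
      + \<alpha> / (2 * g) * (norm (s - x0))\<^sup>2
      + ell / 2 * (\<alpha> * (norm (s - z))\<^sup>2 + (1 - \<alpha>) * \<alpha>\<^sup>2 * (norm (x0 - y0))\<^sup>2)
      + \<alpha> * inner \<xi> (s - x0) - inner \<xi> (y1 - z)"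
proof -
  define u where "u = (1 - \<alpha>) *\<^sub>R y0 + \<alpha> *\<^sub>R x1"
  have uz: "u - z = \<alpha> *\<^sub>R (x1 - x0)" unfolding u_def z by (simp add: algebra_simps)
  have hx1: "h x1 < \<infinity>" by (rule approx_prox_finite[OF h(2) x1])
  have hu: "h u < \<infinity>"
    and hu_le: "real_of_ereal (h u) \<le> (1 - \<alpha>) * real_of_ereal (h y0) + \<alpha> * real_of_ereal (h x1)"
    using y0 ereal_convex_finite[OF h _ hx1, of y0 \<alpha>] hx1 \<alpha> unfolding u_def by auto
  have Y: "real_of_ereal (h y1) + inner (G + \<xi>) (y1 - z) + L * (norm (y1 - z))\<^sup>2
    \<le> \<rho> + real_of_ereal (h u) + \<alpha> * inner (G + \<xi>) (x1 - x0) + L * (\<alpha>\<^sup>2 * (norm (x1 - x0))\<^sup>2)"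
    using approx_prox_gradient_step[OF h(2) y1 hu] L unfolding uz inner_scaleR_right
    by (simp add: mult.commute power_mult_distrib)
  have X: "\<alpha> * (real_of_ereal (h x1) + inner (G + \<xi>) (x1 - x0) + (norm (x1 - x0))\<^sup>2 / (2 * g))
    \<le> \<alpha> * (e + real_of_ereal (h s) + inner (G + \<xi>) (s - x0) + (norm (s - x0))\<^sup>2 / (2 * g))"
    using approx_prox_gradient_step[OF h(2) x1 s g(1)] \<alpha> by simp
  have ls: "\<alpha> * (f z + inner G (s - z) - ell / 2 * (norm (s - z))\<^sup>2) \<le> \<alpha> * f s"
    using lower[of s] \<alpha> by simp
  have "y0 - z = \<alpha> *\<^sub>R (y0 - x0)" unfolding z by (simp add: algebra_simps)
  then have "(norm (y0 - z))\<^sup>2 = \<alpha>\<^sup>2 * (norm (x0 - y0))\<^sup>2"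
    by (simp add: power_mult_distrib norm_minus_commute)
  then have ly: "(1 - \<alpha>) * (f z + inner G (y0 - z) - ell / 2 * (\<alpha>\<^sup>2 * (norm (x0 - y0))\<^sup>2)) \<le> (1 - \<alpha>) * f y0"
    using lower[of y0] \<alpha> by (simp add: mult_left_mono)
  have G: "\<alpha> * inner G (s - z) + (1 - \<alpha>) * inner G (y0 - z) = \<alpha> * inner G (s - x0)"
    unfolding z by (simp add: inner_simps algebra_simps)
  \<comment> \<open>Here the step size restriction \<open>2 * L * \<alpha> * g \<le> 1\<close>
    enters: the penalty of the \<open>x1\<close> step absorbs the quadratic error of testing at
    \<open>u\<close>.\<close>
  have K: "L * (\<alpha>\<^sup>2 * (norm (x1 - x0))\<^sup>2) \<le> \<alpha> * ((norm (x1 - x0))\<^sup>2 / (2 * g))"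
  proof -
    have "L * \<alpha> \<le> 1 / (2 * g)" using g by (simp add: field_simps)
    then have "L * \<alpha> * (\<alpha> * (norm (x1 - x0))\<^sup>2) \<le> 1 / (2 * g) * (\<alpha> * (norm (x1 - x0))\<^sup>2)"
      using \<alpha> by (intro mult_right_mono) auto
    then show ?thesis by (simp add: power2_eq_square mult_ac)
  qed
  have lin: "f z + \<alpha> * inner G (s - x0)
      - ell / 2 * (\<alpha> * (norm (s - z))\<^sup>2 + (1 - \<alpha>) * \<alpha>\<^sup>2 * (norm (x0 - y0))\<^sup>2)
    \<le> \<alpha> * f s + (1 - \<alpha>) * f y0"
    using add_mono[OF ls ly] unfolding G[symmetric] by (simp add: algebra_simps diff_divide_distrib)
  have X': "\<alpha> * real_of_ereal (h x1) + \<alpha> * inner (G + \<xi>) (x1 - x0) + \<alpha> * ((norm (x1 - x0))\<^sup>2 / (2 * g))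
    \<le> \<alpha> * e + \<alpha> * real_of_ereal (h s) + \<alpha> * inner G (s - x0) + \<alpha> * inner \<xi> (s - x0)
      + \<alpha> / (2 * g) * (norm (s - x0))\<^sup>2"
    using X by (simp add: inner_left_distrib distrib_left)
  have "(1 - \<alpha>) * (f y0 + real_of_ereal (h y0) - (f s + real_of_ereal (h s)))
    = (1 - \<alpha>) * f y0 + (1 - \<alpha>) * real_of_ereal (h y0) - f s - real_of_ereal (h s)
      + \<alpha> * f s + \<alpha> * real_of_ereal (h s)"
    by (simp add: algebra_simps)
  then show ?thesis
    using Y[unfolded inner_left_distrib[of G \<xi> "y1 - z"]] X' lin K hu_le upper by linarith
qed

text \<open>Both \<open>y\<close> and \<open>w\<close> lie near the exact noise-free point
  \<open>q\<close>: quadratic growth bounds \<open>w - q\<close> by the inexactness alone and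
  \<open>y - q\<close> by inexactness plus noise. The triangle inequality then transfers the
  residual \<open>y - z\<close> to \<open>w\<close> and \<open>q\<close>.\<close>

lemma prox_gradient_residual_bound:
  fixes h :: "'a::real_inner \<Rightarrow> ereal"
  assumes h: "ereal_convex h" "ereal_proper h" and L: "L > 0"
    and y: "approx_prox \<rho> (1 / (2 * L)) h (z - (1 / (2 * L)) *\<^sub>R (G + \<xi>)) y"
    and w: "approx_prox \<rho> (1 / (2 * L)) h (z - (1 / (2 * L)) *\<^sub>R G) w"
    and q: "approx_prox 0 (1 / (2 * L)) h (z - (1 / (2 * L)) *\<^sub>R G) q"
  shows "L / 16 * ((norm (w - z))\<^sup>2 + (norm (q - z))\<^sup>2)
    \<le> L / 4 * (norm (y - z))\<^sup>2 + 3 / 4 * \<rho> + (norm \<xi>)\<^sup>2 / (2 * L)"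
proof -
  have lam: "1 / (2 * L) > 0" using L by simp
  have hy: "h y < \<infinity>" and hw: "h w < \<infinity>" and hq: "h q < \<infinity>"
    using approx_prox_finite[OF h(2)] y w q by blast+
  define d where "d = norm (y - q)"
  define b where "b = norm (w - q)"
  define D where "D = norm (y - z)"
  have "L * b\<^sup>2 \<le> \<rho>"
    using approx_prox_exact_strong[OF h q hw lam] approx_prox_le[OF h(2) w hq] L
    by (simp add: b_def mult.commute)
  \<comment> \<open>The objectives solved by \<open>y\<close> and by \<open>q\<close> differ only by
    a term linear in \<xi>, up to a constant.\<close>
  have "L * d\<^sup>2 \<le> \<rho> + inner \<xi> (q - y)"
    using approx_prox_exact_strong[OF h q hy lam] approx_prox_gradient_step[OF h(2) y hq lam] L
    unfolding norm_shift_square_div[OF lam]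
    by (simp add: d_def inner_left_distrib inner_diff_right mult.commute)
  also have "inner \<xi> (q - y) \<le> norm \<xi> * d"
    using norm_cauchy_schwarz[of \<xi> "q - y"] by (simp add: d_def norm_minus_commute)
  also have "norm \<xi> * d \<le> L / 4 * d\<^sup>2 + (norm \<xi>)\<^sup>2 / L"
  proof -
    have "0 \<le> (L / 2 * d - norm \<xi>)\<^sup>2 / L" using L by simp
    also have "\<dots> = L / 4 * d\<^sup>2 - norm \<xi> * d + (norm \<xi>)\<^sup>2 / L"
      using L by (simp add: power2_eq_square field_simps)
    finally show ?thesis by simp
  qed
  finally have d: "3 / 4 * (L * d\<^sup>2) \<le> \<rho> + (norm \<xi>)\<^sup>2 / L" by linarith
  have "norm (q - z) \<le> d + D"
    using norm_triangle_ineq[of "q - y" "y - z"] by (simp add: d_def D_def norm_minus_commute)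
  then have "(norm (q - z))\<^sup>2 \<le> (d + D)\<^sup>2" by (simp add: power_mono)
  also have "\<dots> \<le> 2 * D\<^sup>2 + 2 * d\<^sup>2"
    using zero_le_power2[of "d - D"] by (simp add: power2_eq_square algebra_simps)
  finally have qz: "(norm (q - z))\<^sup>2 \<le> 2 * D\<^sup>2 + 2 * d\<^sup>2" .
  have "norm (w - z) \<le> b + d + D"
    using norm_triangle_ineq[of "w - q" "q - z"] \<open>norm (q - z) \<le> d + D\<close> by (simp add: b_def)
  then have "(norm (w - z))\<^sup>2 \<le> (b + d + D)\<^sup>2" by (simp add: power_mono)
  also have "\<dots> \<le> 2 * D\<^sup>2 + 4 * d\<^sup>2 + 4 * b\<^sup>2"
    using zero_le_power2[of "b + d - D"] zero_le_power2[of "b - d"]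
    by (simp add: power2_eq_square algebra_simps)
  finally have wz: "(norm (w - z))\<^sup>2 \<le> 2 * D\<^sup>2 + 4 * d\<^sup>2 + 4 * b\<^sup>2" .
  have "L / 16 * ((norm (w - z))\<^sup>2 + (norm (q - z))\<^sup>2) \<le> L / 16 * (4 * D\<^sup>2 + 6 * d\<^sup>2 + 4 * b\<^sup>2)"
    using qz wz L by (intro mult_left_mono) auto
  also have "\<dots> = L / 4 * D\<^sup>2 + 3 / 8 * (L * d\<^sup>2) + 1 / 4 * (L * b\<^sup>2)" by (simp add: algebra_simps)
  also have "\<dots> \<le> L / 4 * D\<^sup>2 + 3 / 4 * \<rho> + (norm \<xi>)\<^sup>2 / L / 2"
    using d \<open>L * b\<^sup>2 \<le> \<rho>\<close> by argo
  finally show ?thesis by (simp add: D_def mult.commute)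
qed

text \<open>With \<open>K k = k * (k + 1) / 2\<close> one has
  \<open>K k * (1 - 2 / (k + 1)) = K (k - 1)\<close>, so the weighted right-hand sides telescope.
  Since \<open>K 0 = 0\<close>, the initial value \<open>\<Psi> 0\<close> drops out.\<close>

lemma accelerated_weights_telescope:
  fixes A \<Psi> :: "nat \<Rightarrow> real"
  assumes "\<And>k. k \<ge> 1 \<Longrightarrow> A k \<le> (1 - 2 / (real k + 1)) * \<Psi> (k - 1) - \<Psi> k"
  shows "(\<Sum>k = 1..n. real k * (real k + 1) / 2 * A k) \<le> - (real n * (real n + 1) / 2 * \<Psi> n)"
proof (induction n)
  case (Suc n)
  define K where "K = real (Suc n) * (real (Suc n) + 1) / 2"
  have "K * A (Suc n) \<le> K * ((1 - 2 / (real (Suc n) + 1)) * \<Psi> n - \<Psi> (Suc n))"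
    using assms[of "Suc n"] by (intro mult_left_mono) (auto simp: K_def)
  also have "\<dots> = K * (1 - 2 / (real (Suc n) + 1)) * \<Psi> n - K * \<Psi> (Suc n)"
    by (simp add: algebra_simps)
  also have "K * (1 - 2 / (real (Suc n) + 1)) = real n * (real n + 1) / 2"
    by (simp add: K_def field_simps)
  finally show ?case using Suc.IH by (simp add: K_def)
qed simp

text \<open>By the closed form the sum is at least \<open>(T^3 - (T / 2)^3) / 3\<close>, that is
  \<open>7 / 24 * T^3\<close>.\<close>

lemma sum_consecutive_products_ge:
  "(real T)^3 / 4 \<le> (\<Sum>k = T div 2..T. real k * (real k + 1))"
proof -
  have closed: "(\<Sum>k<n. real k * (real k + 1)) = (real n - 1) * real n * (real n + 1) / 3" for n
    by (induction n) (simp_all add: field_simps)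
  define m where "m = T div 2"
  have "(\<Sum>k<Suc T. real k * (real k + 1))
      = (\<Sum>k<m. real k * (real k + 1)) + (\<Sum>k = m..T. real k * (real k + 1))"
    using sum.atLeastLessThan_concat[of 0 m "Suc T" "\<lambda>k. real k * (real k + 1)"]
    unfolding lessThan_atLeast0 by (simp add: m_def flip: atLeastLessThanSuc_atLeastAtMost)
  then have eq: "(\<Sum>k = m..T. real k * (real k + 1))
      = real T * (real T + 1) * (real T + 2) / 3 - (real m - 1) * real m * (real m + 1) / 3"
    unfolding closed by (simp add: field_simps)
  have "(real m)^3 \<le> (real T / 2)^3" by (intro power_mono) (auto simp: m_def)
  then have "(real m)^3 \<le> (real T)^3 / 8" by (simp add: power_divide)
  moreover have "(real m - 1) * real m * (real m + 1) \<le> (real m)^3"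
    by (simp add: power3_eq_cube algebra_simps)
  moreover have "(real T)^3 \<le> real T * (real T + 1) * (real T + 2)"
    by (simp add: power3_eq_cube algebra_simps)
  moreover have "0 \<le> (real T)^3" by simp
  ultimately show ?thesis unfolding eq m_def[symmetric] by linarith
qed

section \<open>Conditional moments\<close>

lemma subalgebra_gen_filtration:
  assumes "\<And>i. i \<ge> 1 \<Longrightarrow> z i \<in> borel_measurable M" "\<And>i. i \<ge> 1 \<Longrightarrow> xib i \<in> borel_measurable M"
  shows "subalgebra M (gen_filtration M z xib k)"
proof -
  define A where "A = (\<Union>i\<in>{1..<k}. {z i -` A \<inter> space M | A. A \<in> sets borel}
    \<union> {xib i -` A \<inter> space M | A. A \<in> sets borel})"
  have "A \<subseteq> sets M" "A \<subseteq> Pow (space M)"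
    using assms unfolding A_def by (auto intro: measurable_sets)
  then show ?thesis
    unfolding subalgebra_def gen_filtration_def A_def[symmetric]
    by (simp add: sets_measure_of space_measure_of sets.sigma_sets_subset)
qed

text \<open>Work coordinatewise: each coordinate of \<open>X\<close> is bounded and measurable for
  \<open>F\<close>, so it can be moved across the conditional expectation, which vanishes.\<close>

lemma (in finite_measure) integral_inner_cond_mean_zero:
  fixes \<xi> X :: "'a \<Rightarrow> 'b::euclidean_space"
  assumes sub: "subalgebra M F" and X: "X \<in> borel_measurable F"
    and bound: "\<And>\<omega>. \<omega> \<in> space M \<Longrightarrow> norm (X \<omega>) \<le> K" and int: "integrable M \<xi>"
    and zero: "\<And>b. b \<in> Basis \<Longrightarrow> AE \<omega> in M. real_cond_exp M F (\<lambda>\<omega>. inner (\<xi> \<omega>) b) \<omega> = 0"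
  shows "integrable M (\<lambda>\<omega>. inner (\<xi> \<omega>) (X \<omega>))" and "(\<integral>\<omega>. inner (\<xi> \<omega>) (X \<omega>) \<partial>M) = 0"
proof -
  interpret finite_measure_subalgebra M F by unfold_locales (rule sub)
  have [measurable]: "X \<in> borel_measurable M" "\<xi> \<in> borel_measurable M"
    using measurable_from_subalg[OF sub X] int by auto
  have *: "integrable M (\<lambda>\<omega>. inner (X \<omega>) b * inner (\<xi> \<omega>) b)"
    "(\<integral>\<omega>. inner (X \<omega>) b * inner (\<xi> \<omega>) b \<partial>M) = 0" if b: "b \<in> Basis" for b
  proof -
    show i: "integrable M (\<lambda>\<omega>. inner (X \<omega>) b * inner (\<xi> \<omega>) b)"
    proof (rule Bochner_Integration.integrable_bound)
      show "integrable M (\<lambda>\<omega>. K * norm (\<xi> \<omega>))" using int by auto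
      show "AE \<omega> in M. norm (inner (X \<omega>) b * inner (\<xi> \<omega>) b) \<le> norm (K * norm (\<xi> \<omega>))"
      proof (rule AE_I2)
        fix \<omega> assume "\<omega> \<in> space M"
        have K: "0 \<le> K" using bound[OF \<open>\<omega> \<in> space M\<close>] norm_ge_zero order_trans by blast
        then have "\<bar>inner (X \<omega>) b\<bar> * \<bar>inner (\<xi> \<omega>) b\<bar> \<le> K * norm (\<xi> \<omega>)"
          using Basis_le_norm[OF b] bound[OF \<open>\<omega> \<in> space M\<close>]
          by (intro mult_mono) (auto intro: order_trans)
        then show "norm (inner (X \<omega>) b * inner (\<xi> \<omega>) b) \<le> norm (K * norm (\<xi> \<omega>))"
          using K by (simp add: abs_mult)
      qed
    qed measurable
    have "(\<lambda>\<omega>. inner (X \<omega>) b) \<in> borel_measurable F" using X by measurable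
    from real_cond_exp_intg(2)[OF i this]
    have "(\<integral>\<omega>. inner (X \<omega>) b * inner (\<xi> \<omega>) b \<partial>M)
        = (\<integral>\<omega>. inner (X \<omega>) b * real_cond_exp M F (\<lambda>\<omega>. inner (\<xi> \<omega>) b) \<omega> \<partial>M)" by simp
    also have "\<dots> = 0" using zero[OF b] by (intro integral_eq_zero_AE) auto
    finally show "(\<integral>\<omega>. inner (X \<omega>) b * inner (\<xi> \<omega>) b \<partial>M) = 0" .
  qed
  have eq: "(\<lambda>\<omega>. inner (\<xi> \<omega>) (X \<omega>)) = (\<lambda>\<omega>. \<Sum>b\<in>Basis. inner (X \<omega>) b * inner (\<xi> \<omega>) b)"
    by (subst euclidean_inner) (simp add: mult.commute)
  show "integrable M (\<lambda>\<omega>. inner (\<xi> \<omega>) (X \<omega>))" unfolding eq using * by auto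
  show "(\<integral>\<omega>. inner (\<xi> \<omega>) (X \<omega>) \<partial>M) = 0" unfolding eq
    using * by (subst Bochner_Integration.integral_sum) auto
qed

text \<open>Testing the conditional expectation against the constant 1 equates the total integrals;
  working with nonnegative integrals yields integrability as well as the bound.\<close>

lemma (in prob_space) integral_le_of_nn_cond_exp_le:
  fixes u :: "'a \<Rightarrow> real"
  assumes sub: "subalgebra M F" and [measurable]: "u \<in> borel_measurable M"
    and nonneg: "\<And>\<omega>. u \<omega> \<ge> 0" and "c \<ge> 0"
    and le: "AE \<omega> in M. nn_cond_exp M F (\<lambda>\<omega>. ennreal (u \<omega>)) \<omega> \<le> ennreal c"
  shows "integrable M u" and "(\<integral>\<omega>. u \<omega> \<partial>M) \<le> c"
proof -
  interpret finite_measure_subalgebra M F by unfold_locales (rule sub)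
  have "(\<integral>\<^sup>+\<omega>. ennreal (u \<omega>) \<partial>M) = (\<integral>\<^sup>+\<omega>. nn_cond_exp M F (\<lambda>\<omega>. ennreal (u \<omega>)) \<omega> \<partial>M)"
    using nn_cond_exp_intg[of "\<lambda>_. 1" "\<lambda>\<omega>. ennreal (u \<omega>)"] by simp
  also have "\<dots> \<le> (\<integral>\<^sup>+\<omega>. ennreal c \<partial>M)" by (rule nn_integral_mono_AE[OF le])
  also have "\<dots> = ennreal c" by (simp add: emeasure_space_1)
  finally have *: "(\<integral>\<^sup>+\<omega>. ennreal (u \<omega>) \<partial>M) \<le> ennreal c" .
  then have "(\<integral>\<^sup>+\<omega>. ennreal (u \<omega>) \<partial>M) < \<infinity>" using le_less_trans by fastforce
  then show "integrable M u" by (intro integrableI_nonneg) (auto simp: nonneg)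
  then have "(\<integral>\<^sup>+\<omega>. ennreal (u \<omega>) \<partial>M) = ennreal (\<integral>\<omega>. u \<omega> \<partial>M)"
    by (intro nn_integral_eq_integral) (auto simp: nonneg)
  with * show "(\<integral>\<omega>. u \<omega> \<partial>M) \<le> c" using \<open>c \<ge> 0\<close> by simp
qed

text \<open>A nonintegrable function has Bochner integral 0, so the summands need not be measurable.\<close>
lemma sum_integral_le_of_sum_le:
  fixes Q :: "'i \<Rightarrow> 'a \<Rightarrow> real"
  assumes "\<And>k \<omega>. k \<in> I \<Longrightarrow> 0 \<le> Q k \<omega>" "\<And>k. k \<in> I \<Longrightarrow> 0 \<le> w k" "integrable M R"
    and "\<And>\<omega>. \<omega> \<in> space M \<Longrightarrow> (\<Sum>k\<in>I. w k * Q k \<omega>) \<le> R \<omega>"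
  shows "(\<Sum>k\<in>I. w k * (\<integral>\<omega>. Q k \<omega> \<partial>M)) \<le> (\<integral>\<omega>. R \<omega> \<partial>M)"
proof -
  define P where "P k \<omega> = (if integrable M (Q k) then Q k \<omega> else 0)" for k \<omega>
  have int: "integrable M (P k)" for k
    unfolding P_def by (cases "integrable M (Q k)") auto
  have "(\<integral>\<omega>. Q k \<omega> \<partial>M) = (\<integral>\<omega>. P k \<omega> \<partial>M)" for k
    by (cases "integrable M (Q k)") (simp_all add: P_def not_integrable_integral_eq)
  then have "(\<Sum>k\<in>I. w k * (\<integral>\<omega>. Q k \<omega> \<partial>M)) = (\<integral>\<omega>. (\<Sum>k\<in>I. w k * P k \<omega>) \<partial>M)"
    using int by (simp add: Bochner_Integration.integral_sum)
  also have "\<dots> \<le> (\<integral>\<omega>. R \<omega> \<partial>M)"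
  proof (rule integral_mono)
    show "integrable M (\<lambda>\<omega>. \<Sum>k\<in>I. w k * P k \<omega>)" using int by simp
    fix \<omega> assume "\<omega> \<in> space M"
    have "(\<Sum>k\<in>I. w k * P k \<omega>) \<le> (\<Sum>k\<in>I. w k * Q k \<omega>)"
      using assms(1,2) by (intro sum_mono mult_left_mono) (auto simp: P_def)
    with assms(4)[OF \<open>\<omega> \<in> space M\<close>] show "(\<Sum>k\<in>I. w k * P k \<omega>) \<le> R \<omega>" by linarith
  qed (rule assms(3))
  finally show ?thesis .
qed

lemma norm_diff_square_le:
  fixes a b :: "'a::real_inner"
  assumes "norm a \<le> p" "norm b \<le> r"
  shows "(norm (a - b))\<^sup>2 \<le> 2 * (p\<^sup>2 + r\<^sup>2)"
proof -
  have "(norm (a - b))\<^sup>2 \<le> (p + r)\<^sup>2"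
    using assms norm_triangle_ineq4[of a b] by (intro power_mono) auto
  also have "\<dots> \<le> 2 * (p\<^sup>2 + r\<^sup>2)"
    using zero_le_power2[of "p - r"] by (simp add: power2_eq_square algebra_simps)
  finally show ?thesis .
qed

section \<open>Convergence rate\<close>

theorem theorem1:
  fixes M :: "'o measure"
    and f :: "'a::euclidean_space \<Rightarrow> real" and gf :: "'a \<Rightarrow> 'a" and h :: "'a \<Rightarrow> ereal"
    and L ell C \<tau> B1 B2 B3 :: real
    and \<alpha> \<gamma> lam \<Gamma> e \<rho> :: "nat \<Rightarrow> real" and Nb :: "nat \<Rightarrow> nat"
    and xi :: "nat \<Rightarrow> nat \<Rightarrow> 'o \<Rightarrow> 'a" and xib :: "nat \<Rightarrow> 'o \<Rightarrow> 'a"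
    and x y z yhat :: "nat \<Rightarrow> 'o \<Rightarrow> 'a" and x0 y0 :: 'a
    and T :: nat
  assumes prob: "prob_space M"
    \<comment> \<open>f smooth with gradient gf; (A1)\<close>
    and grad: "\<And>u. GDERIV f u :> gf u"
    and L_pos: "L > 0" and ell_nonneg: "ell \<ge> 0"
    and A1: "\<And>u v. - (ell / 2) * (norm (v - u))\<^sup>2 \<le> f v - f u - inner (gf u) (v - u)
                   \<and> f v - f u - inner (gf u) (v - u) \<le> (L / 2) * (norm (v - u))\<^sup>2"
    \<comment> \<open>h convex, proper, closed (possibly nonsmooth, extended-valued)\<close>
    and h_convex: "ereal_convex h" and h_proper: "ereal_proper h" and h_lsc: "ereal_lsc h"
    \<comment> \<open>an optimal solution exists\<close>
    and opt: "\<exists>xs. \<forall>u. ereal (f xs) + h xs \<le> ereal (f u) + h u"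
    \<comment> \<open>(A2)\<close>
    and C_pos: "C > 0" and A2: "\<And>g v. g > 0 \<Longrightarrow> norm (prox g h v) \<le> C"
    \<comment> \<open>(A4)\<close>
    and A4: "\<exists>Alg :: 'a \<Rightarrow> real \<Rightarrow> 'a \<Rightarrow> nat \<Rightarrow> 'a. \<exists>a1 a2. a1 > 0 \<and> a2 > 0 \<and>
              (\<forall>c g u0 t. g > 0 \<longrightarrow> t > 0 \<longrightarrow>
                 (norm (Alg c g u0 t - prox g h c))\<^sup>2
                   \<le> (a1 * (norm (u0 - prox g h c))\<^sup>2 + a2) / (real t)\<^sup>2)"
    \<comment> \<open>parameter choices\<close>
    and alpha_def: "\<And>k. \<alpha> k = 2 / (real k + 1)"
    and gamma_def: "\<And>k. \<gamma> k = real k / (4 * L)"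
    and lambda_def: "\<And>k. lam k = 1 / (2 * L)"
    and Gamma_def: "\<And>k. \<Gamma> k = 2 / (real k * (real k + 1))"
    and N_def: "\<And>k. Nb k = k + 1"
    \<comment> \<open>sampled noise and its mini-batch average\<close>
    and xi_meas: "\<And>j k. xi j k \<in> borel_measurable M"
    and xi_int: "\<And>j k. integrable M (xi j k)"
    and xib_def: "\<And>k \<omega>. xib k \<omega> = (1 / real (Nb k)) *\<^sub>R (\<Sum>j = 1..Nb k. xi j k \<omega>)"
    \<comment> \<open>(A3), with F_k generated by z_i, xibar_i, i < k\<close>
    and tau_pos: "\<tau> > 0"
    and A3_mean: "\<And>k j b. k \<ge> 1 \<Longrightarrow> j \<in> {1..Nb k} \<Longrightarrow> b \<in> Basis \<Longrightarrow>
        AE \<omega> in M. real_cond_exp M (gen_filtration M z xib k) (\<lambda>\<omega>. inner (xi j k \<omega>) b) \<omega> = 0"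
    and A3_var: "\<And>k. k \<ge> 1 \<Longrightarrow>
        AE \<omega> in M. nn_cond_exp M (gen_filtration M z xib k) (\<lambda>\<omega>. ennreal ((norm (xib k \<omega>))\<^sup>2)) \<omega>
                     \<le> ennreal (\<tau>\<^sup>2 / real (Nb k))"
    \<comment> \<open>the IPAG iteration\<close>
    and init: "\<And>\<omega>. \<omega> \<in> space M \<Longrightarrow> x 0 \<omega> = x0 \<and> y 0 \<omega> = y0"
    and step1: "\<And>k \<omega>. k \<ge> 1 \<Longrightarrow> \<omega> \<in> space M \<Longrightarrow>
        z k \<omega> = (1 - \<alpha> k) *\<^sub>R y (k - 1) \<omega> + \<alpha> k *\<^sub>R x (k - 1) \<omega>"
    and step2: "\<And>k \<omega>. k \<ge> 1 \<Longrightarrow> \<omega> \<in> space M \<Longrightarrow>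
        approx_prox (e k) (\<gamma> k) h (x (k - 1) \<omega> - \<gamma> k *\<^sub>R (gf (z k \<omega>) + xib k \<omega>)) (x k \<omega>)"
    and step3: "\<And>k \<omega>. k \<ge> 1 \<Longrightarrow> \<omega> \<in> space M \<Longrightarrow>
        approx_prox (\<rho> k) (lam k) h (z k \<omega> - lam k *\<^sub>R (gf (z k \<omega>) + xib k \<omega>)) (y k \<omega>)"
    \<comment> \<open>yhat_k: rho_k-approximate solution of prox_{lambda_k h}(z_k - lambda_k grad f(z_k))\<close>
    and yhat_approx: "\<And>k \<omega>. k \<ge> 1 \<Longrightarrow> \<omega> \<in> space M \<Longrightarrow>
        approx_prox (\<rho> k) (lam k) h (z k \<omega> - lam k *\<^sub>R gf (z k \<omega>)) (yhat k \<omega>)"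
    \<comment> \<open>iterates are random variables, adapted to the filtration\<close>
    and x_meas: "\<And>k. x k \<in> borel_measurable M" and y_meas: "\<And>k. y k \<in> borel_measurable M"
    and yhat_meas: "\<And>k. yhat k \<in> borel_measurable M"
    and adapted: "\<And>k. k \<ge> 1 \<Longrightarrow> x (k - 1) \<in> borel_measurable (gen_filtration M z xib k)
                              \<and> y (k - 1) \<in> borel_measurable (gen_filtration M z xib k)"
    \<comment> \<open>bounds B1, B2, B3\<close>
    and B_pos: "B1 > 0" "B2 > 0" "B3 > 0"
    and bound_x: "\<And>k \<omega>. \<omega> \<in> space M \<Longrightarrow> norm (x k \<omega>) \<le> B1"
    and bound_y: "\<And>k \<omega>. \<omega> \<in> space M \<Longrightarrow> norm (y k \<omega>) \<le> B2"
    and bound_z: "\<And>k \<omega>. k \<ge> 1 \<Longrightarrow> \<omega> \<in> space M \<Longrightarrow> norm (z k \<omega>) \<le> B3"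
    and T_pos: "T > 0"
  shows "let w = (\<lambda>k. (1 - L * lam k) / (16 * lam k * \<Gamma> k));
             W = (\<Sum>k = T div 2..T. w k);
             B = B1\<^sup>2 + B2\<^sup>2 + B3\<^sup>2 + C\<^sup>2
         in (\<Sum>k = T div 2..T. (w k / W) *
               (\<integral>\<omega>. (norm (yhat k \<omega> - z k \<omega>))\<^sup>2
                    + (norm (prox (lam k) h (z k \<omega> - lam k *\<^sub>R gf (z k \<omega>)) - z k \<omega>))\<^sup>2 \<partial>M))
            \<le> 128 / (L * real T ^ 3) *
               (2 * B * real T * (real T + 1) * (ell / 4 + 13 * \<tau>\<^sup>2 / (64 * L * B) + 4 * L)
                + (\<Sum>k = 1..T. 2 * e k / \<Gamma> k + \<rho> k * (1 + real k) / \<Gamma> k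
                                + 4 * L\<^sup>2 * \<rho> k / \<Gamma> k))"
proof -

  \<comment> \<open>Weights and notation\<close>
  interpret prob_space M by (rule prob)
  define hr where "hr u = real_of_ereal (h u)" for u
  define B where "B = B1\<^sup>2 + B2\<^sup>2 + B3\<^sup>2 + C\<^sup>2"
  define K where "K k = real k * (real k + 1) / 2" for k
  define w where "w k = L / 16 * K k" for k
  define W where "W = (\<Sum>k = T div 2..T. w k)"
  define Q where "Q k \<omega> = (norm (yhat k \<omega> - z k \<omega>))\<^sup>2
    + (norm (prox (lam k) h (z k \<omega> - lam k *\<^sub>R gf (z k \<omega>)) - z k \<omega>))\<^sup>2" for k \<omega>
  have B: "B > 0" using B_pos C_pos unfolding B_def by (simp add: add_pos_pos)
  have K_nonneg: "K k \<ge> 0" for k by (simp add: K_def)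
  \<comment> \<open>This also holds at \<open>k = 0\<close>: there \<open>\<Gamma> 0 = 0\<close>
    because division by zero gives 0, and both sides vanish.\<close>
  have Gamma_K: "a / \<Gamma> k = K k * a" for a k
    by (simp add: Gamma_def K_def)
  have w_eq: "(1 - L * lam k) / (16 * lam k * \<Gamma> k) = w k" for k
    using L_pos by (simp add: lambda_def w_def K_def Gamma_def field_simps)

  \<comment> \<open>The optimal solution and the signs of the errors\<close>
  obtain s where s: "\<And>u. ereal (f s) + h s \<le> ereal (f u) + h u" using opt by blast
  obtain u0 where "h u0 < \<infinity>" using h_proper by (auto simp: ereal_proper_def)
  then have "ereal (f u0) + h u0 < \<infinity>" by simp
  then have hs: "h s < \<infinity>" using s[of u0] by (auto dest: le_less_trans)
  have upper: "f v - f u - inner (gf u) (v - u) \<le> L / 2 * (norm (v - u))\<^sup>2" for u v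
    using A1 by blast
  have "prox (1 / L) h (s - (1 / L) *\<^sub>R gf s) = s"
    using L_pos by (intro composite_minimizer_prox_fixed_point[OF h_convex h_proper s upper]) auto
  then have norm_s: "norm s \<le> C" using A2[of "1 / L"] L_pos by (metis zero_less_divide_1_iff)

  have fin_y: "h (y k \<omega>) < \<infinity>" if "k \<ge> 1" "\<omega> \<in> space M" for k \<omega>
    using approx_prox_finite[OF h_proper step3[OF that]] .
  have opt_y: "f s + hr s \<le> f (y k \<omega>) + hr (y k \<omega>)" if "k \<ge> 1" "\<omega> \<in> space M" for k \<omega>
    using s[of "y k \<omega>"] ereal_proper_finite[OF h_proper hs] ereal_proper_finite[OF h_proper fin_y[OF that]]
    unfolding hr_def by (metis ereal_less_eq(3) plus_ereal.simps(1))
  \<comment> \<open>The errors are deterministic, so a single sample point decides their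
    sign.\<close>
  obtain \<omega>0 where \<omega>0: "\<omega>0 \<in> space M" using not_empty by blast
  have e_nonneg: "e k \<ge> 0" and rho_nonneg: "\<rho> k \<ge> 0" if "k \<ge> 1" for k
    using approx_prox_error_nonneg[OF h_proper step2[OF that \<omega>0]]
      approx_prox_error_nonneg[OF h_proper step3[OF that \<omega>0]] .

  \<comment> \<open>One-step inequality for the optimality gap\<close>
  define \<Psi> where "\<Psi> k \<omega> = f (y k \<omega>) + hr (y k \<omega>) - (f s + hr s)" for k \<omega>
  define m where "m k \<omega> = inner (xib k \<omega>) (s - x (k - 1) \<omega>)" for k \<omega>
  \<comment> \<open>The descent inequality leaves
    \<open>L / 2 * (norm (y k \<omega> - z k \<omega>))\<^sup>2\<close>: half pays for the residual
    \<open>Q\<close>, half for the noise paired with \<open>y k - z k\<close>. Hence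
    \<open>7 / 4 = 1 + 3 / 4\<close> for \<open>\<rho> k\<close>, and
    \<open>3 / 2 = 1 + 1 / 2\<close> for the squared noise.\<close>
  define E where "E k \<omega> = 7 / 4 * \<rho> k + \<alpha> k * e k + \<alpha> k / (2 * \<gamma> k) * (norm (s - x (k - 1) \<omega>))\<^sup>2
    + ell / 2 * (\<alpha> k * (norm (s - z k \<omega>))\<^sup>2
        + (1 - \<alpha> k) * (\<alpha> k)\<^sup>2 * (norm (x (k - 1) \<omega> - y (k - 1) \<omega>))\<^sup>2)
    + \<alpha> k * m k \<omega> + 3 / 2 * ((norm (xib k \<omega>))\<^sup>2 / L)" for k \<omega>

  have descent: "L / 16 * Q k \<omega> - E k \<omega> \<le> (1 - 2 / (real k + 1)) * \<Psi> (k - 1) \<omega> - \<Psi> k \<omega>"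
    if k: "k \<ge> 1" and \<omega>: "\<omega> \<in> space M" for k \<omega>
  proof -
    have \<alpha>: "0 < \<alpha> k" "\<alpha> k \<le> 1" using k by (auto simp: alpha_def)
    have \<gamma>: "\<gamma> k > 0" "2 * L * \<alpha> k * \<gamma> k \<le> 1"
      using k L_pos by (auto simp: alpha_def gamma_def field_simps)
    \<comment> \<open>In the first iteration \<open>\<alpha> 1 = 1\<close>, so nothing is needed
      about \<open>h\<close> at the initial point.\<close>
    have y0: "h (y (k - 1) \<omega>) < \<infinity> \<or> \<alpha> k = 1"
      using fin_y[of "k - 1"] \<omega> k by (cases "k = 1") (auto simp: alpha_def)
    have lower: "f (z k \<omega>) + inner (gf (z k \<omega>)) (v - z k \<omega>) - ell / 2 * (norm (v - z k \<omega>))\<^sup>2 \<le> f v" for v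
      using A1[of v "z k \<omega>"] by linarith
    have up: "f (y k \<omega>) \<le> f (z k \<omega>) + inner (gf (z k \<omega>)) (y k \<omega> - z k \<omega>) + L / 2 * (norm (y k \<omega> - z k \<omega>))\<^sup>2"
      using upper[of "y k \<omega>" "z k \<omega>"] by linarith
    note y = step3[OF k \<omega>, unfolded lambda_def]
    have q: "approx_prox 0 (1 / (2 * L)) h (z k \<omega> - (1 / (2 * L)) *\<^sub>R gf (z k \<omega>))
        (prox (1 / (2 * L)) h (z k \<omega> - (1 / (2 * L)) *\<^sub>R gf (z k \<omega>)))"
      by (rule prox_exists_of_composite_minimizer[OF h_proper h_lsc s upper L_pos])
    have res: "L / 16 * Q k \<omega> \<le> L / 4 * (norm (y k \<omega> - z k \<omega>))\<^sup>2 + 3 / 4 * \<rho> k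
        + (norm (xib k \<omega>))\<^sup>2 / L / 2"
      using prox_gradient_residual_bound[OF h_convex h_proper L_pos y
          yhat_approx[OF k \<omega>, unfolded lambda_def] q]
      by (simp add: Q_def lambda_def mult.commute)
    have young: "- inner (xib k \<omega>) (y k \<omega> - z k \<omega>)
      \<le> L / 4 * (norm (y k \<omega> - z k \<omega>))\<^sup>2 + (norm (xib k \<omega>))\<^sup>2 / L"
    proof -
      define a b where "a = norm (xib k \<omega>)" and "b = norm (y k \<omega> - z k \<omega>)"
      have "- inner (xib k \<omega>) (y k \<omega> - z k \<omega>) \<le> a * b"
        using norm_cauchy_schwarz[of "- xib k \<omega>" "y k \<omega> - z k \<omega>"] by (simp add: a_def b_def)
      moreover have "0 \<le> (L / 2 * b - a)\<^sup>2 / L" using L_pos by simp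
      moreover have "(L / 2 * b - a)\<^sup>2 / L = L / 4 * b\<^sup>2 - a * b + a\<^sup>2 / L"
        using L_pos by (simp add: power2_eq_square field_simps)
      ultimately show ?thesis unfolding a_def b_def by linarith
    qed
    define c where "c = (1 - \<alpha> k) * \<Psi> (k - 1) \<omega> + \<alpha> k * e k
        + \<alpha> k / (2 * \<gamma> k) * (norm (s - x (k - 1) \<omega>))\<^sup>2
        + ell / 2 * (\<alpha> k * (norm (s - z k \<omega>))\<^sup>2
          + (1 - \<alpha> k) * (\<alpha> k)\<^sup>2 * (norm (x (k - 1) \<omega> - y (k - 1) \<omega>))\<^sup>2)
        + \<alpha> k * m k \<omega>"
    have "\<Psi> k \<omega> + L / 2 * (norm (y k \<omega> - z k \<omega>))\<^sup>2
        \<le> c + \<rho> k - inner (xib k \<omega>) (y k \<omega> - z k \<omega>)"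
      using accelerated_prox_step_descent[OF h_convex h_proper L_pos lower up \<alpha> \<gamma> step1[OF k \<omega>] y0 hs
          step2[OF k \<omega>] y]
      by (simp add: c_def \<Psi>_def hr_def m_def)
    with res young have "L / 16 * Q k \<omega> \<le> c - \<Psi> k \<omega> + 7 / 4 * \<rho> k + 3 / 2 * ((norm (xib k \<omega>))\<^sup>2 / L)"
      by argo
    then show ?thesis by (simp add: c_def E_def flip: alpha_def)
  qed

  \<comment> \<open>Bounding the weighted errors by means of the bounded iterates\<close>
  define R where "R k = K k * (2 * e k + \<rho> k * (1 + real k)) + real k * (16 * L * B + ell * B)" for k
  have E_bound: "K k * E k \<omega> \<le> R k + real k * m k \<omega> + 3 / 2 * K k / L * (norm (xib k \<omega>))\<^sup>2"
    if k: "k \<ge> 1" and \<omega>: "\<omega> \<in> space M" for k \<omega>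
  proof -
    have k': "real k \<ge> 1" using k by simp
    have K\<alpha>: "K k * \<alpha> k = real k" by (simp add: K_def alpha_def)
    \<comment> \<open>Since \<open>k \<ge> 1\<close>, the coefficient \<open>7 / 4\<close> is below
      \<open>1 + k\<close>.\<close>
    have r: "K k * (7 / 4 * \<rho> k) \<le> K k * (\<rho> k * (1 + real k))"
      using mult_right_mono[of "7 / 4" "1 + real k" "\<rho> k"] rho_nonneg[OF k] k'
      by (intro mult_left_mono K_nonneg) (simp add: mult.commute)
    have ee: "K k * (\<alpha> k * e k) \<le> K k * (2 * e k)"
      using e_nonneg[OF k] k' by (intro mult_left_mono mult_right_mono K_nonneg) (auto simp: alpha_def field_simps)
    have xx: "K k * (\<alpha> k / (2 * \<gamma> k) * (norm (s - x (k - 1) \<omega>))\<^sup>2) \<le> real k * (16 * L * B)"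
    proof -
      have "K k * (\<alpha> k / (2 * \<gamma> k)) = 2 * L"
        unfolding times_divide_eq_right K\<alpha> using k' L_pos by (simp add: gamma_def)
      then have "K k * (\<alpha> k / (2 * \<gamma> k) * (norm (s - x (k - 1) \<omega>))\<^sup>2) = 2 * L * (norm (s - x (k - 1) \<omega>))\<^sup>2"
        by (metis mult.assoc)
      also have "\<dots> \<le> 2 * L * (2 * (C\<^sup>2 + B1\<^sup>2))"
        using L_pos norm_diff_square_le[OF norm_s bound_x[OF \<omega>]] by (intro mult_left_mono) auto
      also have "\<dots> \<le> 2 * L * (2 * B)" using L_pos by (intro mult_left_mono) (auto simp: B_def)
      \<comment> \<open>A deliberately loose step: the constant 16 produces the summand
        \<open>4 * L\<close> of the final bound.\<close>
      also have "\<dots> \<le> real k * (16 * L * B)"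
        using mult_mono[OF k', of "4 * L * B" "16 * L * B"] L_pos B by simp
      finally show ?thesis .
    qed
    have ll: "K k * (ell / 2 * (\<alpha> k * (norm (s - z k \<omega>))\<^sup>2
        + (1 - \<alpha> k) * (\<alpha> k)\<^sup>2 * (norm (x (k - 1) \<omega> - y (k - 1) \<omega>))\<^sup>2)) \<le> real k * (ell * B)"
    proof -
      define a b where "a = (norm (s - z k \<omega>))\<^sup>2" and "b = (norm (x (k - 1) \<omega> - y (k - 1) \<omega>))\<^sup>2"
      have a: "a \<le> 2 * (C\<^sup>2 + B3\<^sup>2)" and b: "b \<le> 2 * (B1\<^sup>2 + B2\<^sup>2)" "0 \<le> b"
        unfolding a_def b_def
        using norm_diff_square_le[OF norm_s bound_z[OF k \<omega>]] norm_diff_square_le[OF bound_x[OF \<omega>] bound_y[OF \<omega>]]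
        by auto
      have "(1 - \<alpha> k) * \<alpha> k \<le> 1"
        using k' by (intro mult_le_one) (auto simp: alpha_def)
      then have "(1 - \<alpha> k) * \<alpha> k * b \<le> 1 * b" using b(2) by (rule mult_right_mono)
      \<comment> \<open>The two distances involve the four bounds \<open>C\<close>,
        \<open>B3\<close>, \<open>B1\<close>, \<open>B2\<close> once each, so they add up to exactly
        \<open>2 * B\<close>.\<close>
      then have "a + (1 - \<alpha> k) * \<alpha> k * b \<le> 2 * B" using a b(1) by (simp add: B_def)
      then have "ell / 2 * (a + (1 - \<alpha> k) * \<alpha> k * b) \<le> ell / 2 * (2 * B)"
        using ell_nonneg by (intro mult_left_mono) auto
      then have "real k * (ell / 2 * (a + (1 - \<alpha> k) * \<alpha> k * b)) \<le> real k * (ell * B)"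
        by (intro mult_left_mono) auto
      moreover have "K k * (ell / 2 * (\<alpha> k * a + (1 - \<alpha> k) * (\<alpha> k)\<^sup>2 * b))
          = (K k * \<alpha> k) * (ell / 2 * (a + (1 - \<alpha> k) * \<alpha> k * b))"
        by (simp add: power2_eq_square algebra_simps)
      ultimately show ?thesis unfolding K\<alpha> a_def b_def by (simp only:)
    qed
    have mm: "K k * (\<alpha> k * m k \<omega>) \<le> real k * m k \<omega>"
      using K\<alpha> by (metis mult.assoc order_refl)
    have "K k * E k \<omega> \<le> K k * (\<rho> k * (1 + real k)) + K k * (2 * e k) + real k * (16 * L * B)
        + real k * (ell * B) + real k * m k \<omega> + K k * (3 / 2 * ((norm (xib k \<omega>))\<^sup>2 / L))"
      unfolding E_def distrib_left[of "K k"] by (intro add_mono r ee xx ll mm order_refl)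
    also have "\<dots> = R k + real k * m k \<omega> + 3 / 2 * K k / L * (norm (xib k \<omega>))\<^sup>2"
      by (simp add: R_def algebra_simps)
    finally show ?thesis .
  qed

  \<comment> \<open>Summing over the iterations for a fixed sample point\<close>
  define G where "G \<omega> = (\<Sum>k = 1..T. R k + real k * m k \<omega> + 3 / 2 * K k / L * (norm (xib k \<omega>))\<^sup>2)" for \<omega>
  have pointwise: "(\<Sum>k = T div 2..T. w k * Q k \<omega>) \<le> G \<omega>" if \<omega>: "\<omega> \<in> space M" for \<omega>
  proof -
    have "(\<Sum>k = 1..T. K k * (L / 16 * Q k \<omega> - E k \<omega>)) \<le> - (K T * \<Psi> T \<omega>)"
      using accelerated_weights_telescope[of "\<lambda>k. L / 16 * Q k \<omega> - E k \<omega>" "\<lambda>k. \<Psi> k \<omega>" T] descent \<omega>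
      unfolding K_def by blast
    also have "\<dots> \<le> 0" using opt_y[of T \<omega>] T_pos \<omega> K_nonneg[of T] by (simp add: \<Psi>_def)
    finally have "(\<Sum>k = 1..T. w k * Q k \<omega>) \<le> (\<Sum>k = 1..T. K k * E k \<omega>)"
      by (simp add: w_def right_diff_distrib sum_subtractf mult_ac)
    also have "\<dots> \<le> G \<omega>" unfolding G_def using E_bound \<omega> by (intro sum_mono) auto
    finally have 1: "(\<Sum>k = 1..T. w k * Q k \<omega>) \<le> G \<omega>" .
    have wQ: "0 \<le> w k * Q k \<omega>" for k using L_pos K_nonneg by (simp add: w_def Q_def)
    \<comment> \<open>The index 0 occurs only for \<open>T = 1\<close>, and
      \<open>w 0 = 0\<close>.\<close>
    have "(\<Sum>k = T div 2..T. w k * Q k \<omega>) = (\<Sum>k \<in> {T div 2..T} - {0}. w k * Q k \<omega>)"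
      by (rule sum.mono_neutral_right) (auto simp: w_def K_def)
    also have "\<dots> \<le> (\<Sum>k = 1..T. w k * Q k \<omega>)"
      by (rule sum_mono2) (auto simp: wQ)
    finally show ?thesis using 1 by simp
  qed

  \<comment> \<open>Measurability and moments of the noise\<close>
  have xib_meas: "xib k \<in> borel_measurable M" for k
  proof -
    have "xib k = (\<lambda>\<omega>. (1 / real (Nb k)) *\<^sub>R (\<Sum>j = 1..Nb k. xi j k \<omega>))" using xib_def by auto
    then show ?thesis using xi_meas by simp
  qed
  have z_meas: "z k \<in> borel_measurable M" if "k \<ge> 1" for k
  proof -
    have "(\<lambda>\<omega>. (1 - \<alpha> k) *\<^sub>R y (k - 1) \<omega> + \<alpha> k *\<^sub>R x (k - 1) \<omega>) \<in> borel_measurable M"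
      using x_meas y_meas by simp
    then show ?thesis using step1[OF that] by (simp cong: measurable_cong)
  qed
  have sub: "subalgebra M (gen_filtration M z xib k)" for k
    using subalgebra_gen_filtration[of z M xib] z_meas xib_meas by blast
  have m: "integrable M (m k)" "(\<integral>\<omega>. m k \<omega> \<partial>M) = 0" if k: "k \<ge> 1" for k
  proof -
    \<comment> \<open>\<open>s\<close> is deterministic and \<open>x (k - 1)\<close> is known to the
      filtration at time \<open>k\<close>, so the noise is paired with a predictable vector.\<close>
    have X: "(\<lambda>\<omega>. s - x (k - 1) \<omega>) \<in> borel_measurable (gen_filtration M z xib k)"
      using adapted[OF k] by (intro borel_measurable_diff) auto
    have bd: "norm (s - x (k - 1) \<omega>) \<le> C + B1" if "\<omega> \<in> space M" for \<omega>
      using norm_triangle_ineq4[of s "x (k - 1) \<omega>"] norm_s bound_x[OF that, of "k - 1"] by linarith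
    have zero: "integrable M (\<lambda>\<omega>. inner (xi j k \<omega>) (s - x (k - 1) \<omega>))"
      "(\<integral>\<omega>. inner (xi j k \<omega>) (s - x (k - 1) \<omega>) \<partial>M) = 0" if "j \<in> {1..Nb k}" for j
      using integral_inner_cond_mean_zero[OF sub X bd xi_int A3_mean[OF k that]] by auto
    have eq: "m k = (\<lambda>\<omega>. (1 / real (Nb k)) * (\<Sum>j = 1..Nb k. inner (xi j k \<omega>) (s - x (k - 1) \<omega>)))"
      by (auto simp: m_def xib_def inner_sum_left)
    show "integrable M (m k)" unfolding eq
      by (intro integrable_mult_right Bochner_Integration.integrable_sum zero(1))
    show "(\<integral>\<omega>. m k \<omega> \<partial>M) = 0" unfolding eq using zero
      by (subst integral_mult_right_zero, subst Bochner_Integration.integral_sum) auto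
  qed
  have n: "integrable M (\<lambda>\<omega>. (norm (xib k \<omega>))\<^sup>2)" "(\<integral>\<omega>. (norm (xib k \<omega>))\<^sup>2 \<partial>M) \<le> \<tau>\<^sup>2 / (real k + 1)"
    if k: "k \<ge> 1" for k
    using integral_le_of_nn_cond_exp_le[OF sub _ _ _ A3_var[OF k]] xib_meas
    by (simp_all add: N_def add.commute)

  \<comment> \<open>Taking expectations\<close>
  have G_int: "integrable M G"
    unfolding G_def using m n by (intro Bochner_Integration.integrable_sum Bochner_Integration.integrable_add) auto
  have "(\<integral>\<omega>. G \<omega> \<partial>M) = (\<Sum>k = 1..T. R k + 3 / 2 * K k / L * (\<integral>\<omega>. (norm (xib k \<omega>))\<^sup>2 \<partial>M))"
    unfolding G_def using m n
    by (subst Bochner_Integration.integral_sum) (auto intro!: sum.cong simp: prob_space)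
  also have "\<dots> \<le> (\<Sum>k = 1..T. R k + real k * (13 * \<tau>\<^sup>2 / (16 * L)))"
  proof (rule sum_mono)
    fix k assume "k \<in> {1..T}"
    then have k: "k \<ge> 1" by simp
    have "3 / 2 * K k / L * (\<integral>\<omega>. (norm (xib k \<omega>))\<^sup>2 \<partial>M) \<le> 3 / 2 * K k / L * (\<tau>\<^sup>2 / (real k + 1))"
      using n(2)[OF k] K_nonneg[of k] L_pos by (intro mult_left_mono) auto
    also have "\<dots> = 3 / 2 * \<tau>\<^sup>2 / L * (K k / (real k + 1))" by simp
    \<comment> \<open>The batch size \<open>k + 1\<close> cancels one factor of \<open>K k\<close>,
      so the variance grows only linearly in \<open>k\<close>, like the other errors.\<close>
    also have "K k / (real k + 1) = real k / 2"
      by (subst divide_eq_eq) (auto simp: K_def)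
    also have "3 / 2 * \<tau>\<^sup>2 / L * (real k / 2) = real k * (12 * \<tau>\<^sup>2 / (16 * L))" by simp
    \<comment> \<open>The argument yields 12; it is relaxed to the constant 13 of the claim.\<close>
    also have "\<dots> \<le> real k * (13 * \<tau>\<^sup>2 / (16 * L))"
      using L_pos by (intro mult_left_mono divide_right_mono) auto
    finally show "R k + 3 / 2 * K k / L * (\<integral>\<omega>. (norm (xib k \<omega>))\<^sup>2 \<partial>M) \<le> R k + real k * (13 * \<tau>\<^sup>2 / (16 * L))"
      by simp
  qed
  also have "\<dots> = (\<Sum>k = 1..T. K k * (2 * e k + \<rho> k * (1 + real k)))
      + (\<Sum>k = 1..T. real k) * (16 * L * B + ell * B + 13 * \<tau>\<^sup>2 / (16 * L))"
    by (simp add: R_def sum.distrib sum_distrib_right distrib_left sum_divide_distrib)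
  also have "(\<Sum>k = 1..T. real k) = real T * (real T + 1) / 2"
    by (induction T) (simp_all add: field_simps)
  also have "real T * (real T + 1) / 2 * (16 * L * B + ell * B + 13 * \<tau>\<^sup>2 / (16 * L))
      = 2 * B * real T * (real T + 1) * (ell / 4 + 13 * \<tau>\<^sup>2 / (64 * L * B) + 4 * L)"
    using B L_pos by (simp add: field_simps)
  \<comment> \<open>The nonnegative summand with \<open>4 * L\<^sup>2 * \<rho> k\<close> is added as
    slack.\<close>
  also have "(\<Sum>k = 1..T. K k * (2 * e k + \<rho> k * (1 + real k)))
      \<le> (\<Sum>k = 1..T. 2 * e k / \<Gamma> k + \<rho> k * (1 + real k) / \<Gamma> k + 4 * L\<^sup>2 * \<rho> k / \<Gamma> k)"
    using K_nonneg rho_nonneg by (intro sum_mono) (simp add: Gamma_K distrib_left)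
  finally have G_le: "(\<integral>\<omega>. G \<omega> \<partial>M)
      \<le> 2 * B * real T * (real T + 1) * (ell / 4 + 13 * \<tau>\<^sup>2 / (64 * L * B) + 4 * L)
        + (\<Sum>k = 1..T. 2 * e k / \<Gamma> k + \<rho> k * (1 + real k) / \<Gamma> k + 4 * L\<^sup>2 * \<rho> k / \<Gamma> k)" (is "_ \<le> ?R")
    by (simp add: add.commute)

  \<comment> \<open>Normalizing by the total weight\<close>
  define S where "S = (\<Sum>k = T div 2..T. w k * (\<integral>\<omega>. Q k \<omega> \<partial>M))"
  have Q_nonneg: "Q k \<omega> \<ge> 0" for k \<omega> by (simp add: Q_def)
  have w_nonneg: "w k \<ge> 0" for k using L_pos K_nonneg by (simp add: w_def)
  \<comment> \<open>Only nonnegativity of \<open>Q k\<close> is supplied here, so measurability of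
    the proximal map does not have to be established.\<close>
  have "S \<le> (\<integral>\<omega>. G \<omega> \<partial>M)" unfolding S_def
    by (rule sum_integral_le_of_sum_le) (auto simp: w_nonneg G_int pointwise Q_nonneg)
  with G_le have SR: "S \<le> ?R" by linarith
  have "S \<ge> 0" unfolding S_def by (intro sum_nonneg mult_nonneg_nonneg w_nonneg
      Bochner_Integration.integral_nonneg Q_nonneg)
  have W_ge: "L * real T ^ 3 / 128 \<le> W"
  proof -
    have "W = L / 32 * (\<Sum>k = T div 2..T. real k * (real k + 1))"
      by (simp add: W_def w_def K_def sum_distrib_left)
    moreover have "L / 32 * (real T ^ 3 / 4) \<le> L / 32 * (\<Sum>k = T div 2..T. real k * (real k + 1))"
      using sum_consecutive_products_ge L_pos by (intro mult_left_mono) auto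
    ultimately show ?thesis by simp
  qed
  \<comment> \<open>Enlarging the numerator and shrinking the denominator is legitimate because
    \<open>0 \<le> S \<le> ?R\<close>. The quotient \<open>S / W\<close> is the expectation over the
    random output index.\<close>
  have "S / W \<le> ?R / (L * real T ^ 3 / 128)"
    using SR \<open>S \<ge> 0\<close> W_ge L_pos T_pos by (intro frac_le) auto
  moreover have "S / W = (\<Sum>k = T div 2..T. (w k / W) * (\<integral>\<omega>. Q k \<omega> \<partial>M))"
    by (simp add: S_def sum_divide_distrib)
  ultimately show ?thesis
    unfolding Let_def w_eq W_def[symmetric] B_def[symmetric] Q_def[symmetric]
    by (simp add: mult.commute)
qed

end
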